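(* Let $n\geq 3$ and $m\geq 1$. Then $\operatorname{sdepth}(S_{n,m}/I(\mathcal{C}_{n,m}))\leq \left\lceil\frac{n}{3}\right\rceil\left\lceil\frac{m}{3}\right\rceil$.
   Context: $K$ is a field. For a finite simple graph $G$ whose vertices are the variables of a polynomial ring over $K$, the edge ideal $I(G)$ is the squarefree monomial ideal generated by all products $uv$ with $\{u,v\}\in E(G)$. $P_m$ is the path on $m$ vertices ($P_1$ is a single vertex with no edges) and $C_n$ ($n\ge 3$) is the cycle on $n$ vertices. The strong product $G_1\boxtimes G_2$ has vertex set $V(G_1)\times V(G_2)$, and two distinct vertices $(v_1,u_1),(v_2,u_2)$ are adjacent iff each coordinate pair is equal or adjacent ($v_1=v_2$ or $v_1v_2\in E(G_1)$, and $u_1=u_2$ or $u_1u_2\in E(G_2)$). Put $\mathcal{C}_{n,m}:=C_n\boxtimes P_m$, with vertices labelled by variables $x_{ij}$ ($1\le i\le n$, $1\le j\le m$), so that distinct $x_{ij},x_{kl}$ are adjacent iff $i-k\in\{-1,0,1\}$ modulo $n$ and $|j-l|\le 1$. $S_{n,m}:=K[x_{ij}:1\le i\le n,\ 1\le j\le m]$. Stanley depth: let $S=K[x_1,\dots,x_N]$ and $M$ a finitely generated $\mathbb{Z}^N$-graded $S$-module. A Stanley decomposition $\mathcal{D}$ of $M$ is a finite direct sum of $K$-vector spaces $M=\bigoplus_{i=1}^r w_iK[A_i]$ with $w_i\in M$ homogeneous, $A_i\subseteq\{x_1,\dots,x_N\}$, where $w_iK[A_i]$ (the $K$-span of all $w_iu$,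 $u$ a monomial in $K[A_i]$) is a free $K[A_i]$-module. $\operatorname{sdepth}(\mathcal{D})=\min_i|A_i|$ and $\operatorname{sdepth}(M)$ is the maximum of $\operatorname{sdepth}(\mathcal{D})$ over all Stanley decompositions $\mathcal{D}$ of $M$. *)

theory Defs
  imports Complex_Main "HOL-Algebra.QuotRing" "HOL-Algebra.Module"
    "HOL-Library.Poly_Mapping" "HOL-Library.FuncSet"
begin

text \<open>Finite simple graphs as a vertex set together with a set of two-element edges.\<close>

type_synonym 'v sgraph = "'v set \<times> 'v set set"

abbreviation verts :: "'v sgraph \<Rightarrow> 'v set" where "verts G \<equiv> fst G"
abbreviation edges :: "'v sgraph \<Rightarrow> 'v set set" where "edges G \<equiv> snd G"

definition path_graph :: "nat \<Rightarrow> nat sgraph" where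
  "path_graph m = ({1..m}, {{i, i + 1} | i. 1 \<le> i \<and> i + 1 \<le> m})"

text \<open>Meant for \<open>n \<ge> 3\<close> only; for smaller \<open>n\<close> it is not a cycle.\<close>

definition cycle_graph :: "nat \<Rightarrow> nat sgraph" where
  "cycle_graph n = ({1..n}, {{i, i + 1} | i. 1 \<le> i \<and> i + 1 \<le> n} \<union> {{n, 1}})"

definition strong_product :: "'a sgraph \<Rightarrow> 'b sgraph \<Rightarrow> ('a \<times> 'b) sgraph" where
  "strong_product G H =
     (verts G \<times> verts H,
      {{(v1, u1), (v2, u2)} | v1 u1 v2 u2.
         v1 \<in> verts G \<and> v2 \<in> verts G \<and> u1 \<in> verts H \<and> u2 \<in> verts H \<and>
         (v1, u1) \<noteq> (v2, u2) \<and>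
         (v1 = v2 \<or> {v1, v2} \<in> edges G) \<and> (u1 = u2 \<or> {u1, u2} \<in> edges H)})"

text \<open>
  Polynomials over the field \<open>'k\<close> in variables from \<open>'v\<close> are finitely supported maps from
  exponent vectors to coefficients. The ring \<open>K[V]\<close> for \<open>V :: 'v set\<close> consists of the
  polynomials all of whose monomials involve only variables in \<open>V\<close>.
\<close>

type_synonym ('v, 'k) mpolynomial = "('v \<Rightarrow>\<^sub>0 nat) \<Rightarrow>\<^sub>0 'k"

definition poly_ring_on :: "'v set \<Rightarrow> ('v, 'k::field) mpolynomial ring" where
  "poly_ring_on V =
     \<lparr>carrier = {p. \<forall>t \<in> Poly_Mapping.keys p. Poly_Mapping.keys t \<subseteq> V},
      mult = (*), one = 1, zero = 0, add = (+)\<rparr>"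

definition variable :: "'v \<Rightarrow> ('v, 'k::field) mpolynomial" where
  "variable v = Poly_Mapping.single (Poly_Mapping.single v 1) 1"

definition edge_ideal :: "'v sgraph \<Rightarrow> ('v, 'k::field) mpolynomial set" where
  "edge_ideal G =
     Idl\<^bsub>poly_ring_on (verts G)\<^esub> {variable u * variable v | u v. {u, v} \<in> edges G}"

text \<open>
  The quotient \<open>R/I\<close> as an \<open>R\<close>-module. The fields \<open>mult\<close> and \<open>one\<close>, which the module record
  inherits from the ring record, are irrelevant for the module structure.
\<close>

definition quot_module :: "('a, 'b) ring_scheme \<Rightarrow> 'a set \<Rightarrow> ('a, 'a set) module" where
  "quot_module R I =
     \<lparr>carrier = carrier (R Quot I), mult = mult (R Quot I), one = one (R Quot I),
      zero = zero (R Quot I), add = add (R Quot I),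
      smult = (\<lambda>r Y. (I +>\<^bsub>R\<^esub> r) \<otimes>\<^bsub>R Quot I\<^esub> Y)\<rparr>"

text \<open>
  The component of degree \<open>a\<close> in the fine grading of \<open>K[V]/I\<close>, for a monomial ideal \<open>I\<close>:
  the image of the polynomials whose monomials all have exponent vector \<open>a\<close>. It is zero if
  \<open>a\<close> has a negative entry or a nonzero entry outside \<open>V\<close>.
\<close>

definition quot_component ::
  "'v set \<Rightarrow> ('v, 'k::field) mpolynomial set \<Rightarrow> ('v \<Rightarrow> int) \<Rightarrow> ('v, 'k) mpolynomial set set" where
  "quot_component V I a =
     {I +>\<^bsub>poly_ring_on V\<^esub> p | p. p \<in> carrier (poly_ring_on V) \<and>
        (\<forall>t \<in> Poly_Mapping.keys p. \<forall>v. int (Poly_Mapping.lookup t v) = a v)}"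

text \<open>
  In the following, \<open>M\<close> is a module over \<open>K[V]\<close> and \<open>C a\<close> its graded component of degree \<open>a\<close>.
\<close>

definition stanley_space ::
  "(('v, 'k::field) mpolynomial, 'm, 'b) module_scheme \<Rightarrow> 'm \<Rightarrow> 'v set \<Rightarrow> 'm set" where
  "stanley_space M w A = (\<lambda>p. p \<odot>\<^bsub>M\<^esub> w) ` carrier (poly_ring_on A)"

text \<open>
  A decomposition is the list of the pairs \<open>(w\<^sub>i, A\<^sub>i)\<close>. The injectivity condition says that
  \<open>w\<^sub>i K[A\<^sub>i]\<close> is free over \<open>K[A\<^sub>i]\<close> with basis \<open>w\<^sub>i\<close>; the last condition says that
  \<open>M\<close> is the direct sum of these spaces.
\<close>

definition stanley_decomposition ::
  "'v set \<Rightarrow> (('v, 'k::field) mpolynomial, 'm, 'b) module_scheme \<Rightarrow> (('v \<Rightarrow> int) \<Rightarrow> 'm set) \<Rightarrow>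
   ('m \<times> 'v set) list \<Rightarrow> bool" where
  "stanley_decomposition V M C D \<longleftrightarrow>
     (\<forall>(w, A) \<in> set D.
        w \<in> carrier M \<and> (\<exists>a. w \<in> C a) \<and> A \<subseteq> V \<and>
        inj_on (\<lambda>p. p \<odot>\<^bsub>M\<^esub> w) (carrier (poly_ring_on A))) \<and>
     (\<forall>z \<in> carrier M.
        \<exists>!f. f \<in> (\<Pi>\<^sub>E i\<in>{..<length D}. stanley_space M (fst (D ! i)) (snd (D ! i))) \<and>
             z = finsum M f {..<length D})"

text \<open>
  Only the zero module has an empty decomposition, so the minimum below is over a nonempty set
  whenever \<open>M\<close> is nonzero; the maximum is then over a set of numbers at most \<open>card V\<close>.
\<close>

definition decomposition_depth :: "('m \<times> 'v set) list \<Rightarrow> nat" where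
  "decomposition_depth D = Min ((\<lambda>(w, A). card A) ` set D)"

definition stanley_depth ::
  "'v set \<Rightarrow> (('v, 'k::field) mpolynomial, 'm, 'b) module_scheme \<Rightarrow> (('v \<Rightarrow> int) \<Rightarrow> 'm set) \<Rightarrow> nat"
  where
  "stanley_depth V M C = Max {decomposition_depth D | D. stanley_decomposition V M C D}"

text \<open>\<open>sdepth(S/I)\<close> for \<open>S = K[V]\<close> and a monomial ideal \<open>I\<close> of \<open>S\<close>.\<close>

definition sdepth_quotient :: "'v set \<Rightarrow> ('v, 'k::field) mpolynomial set \<Rightarrow> nat" where
  "sdepth_quotient V I =
     stanley_depth V (quot_module (poly_ring_on V) I) (quot_component V I)"

text \<open>The vertex \<open>(i, j)\<close> of the following graph stands for the variable \<open>x\<^sub>i\<^sub>j\<close>.\<close>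

definition cycle_strong_path :: "nat \<Rightarrow> nat \<Rightarrow> (nat \<times> nat) sgraph" where
  "cycle_strong_path n m = strong_product (cycle_graph n) (path_graph m)"

end

theory Submission imports Defs begin

text \<open>
  Let \<open>I\<close> be a squarefree monomial ideal, given by the simplicial complex \<open>\<Delta>\<close> of the sets \<open>F\<close>
  with \<open>x\<^sub>F \<notin> I\<close>. The Stanley depth of \<open>S/I\<close> is at most the size of every facet \<open>W\<close> of \<open>\<Delta>\<close>.
  Indeed, the residue class of \<open>x\<^sub>W\<close> is nonzero, so in every Stanley decomposition it must, up to a
  scalar, be a monomial multiple \<open>x\<^sup>s w\<^sub>i\<close> inside some \<open>w\<^sub>i K[A\<^sub>i]\<close>. If \<open>A\<^sub>i\<close> contained
  a variable \<open>x\<^sub>v\<close> outside \<open>W\<close>, then \<open>x\<^sub>v x\<^sup>s w\<^sub>i\<close> would be a multiple of the class of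
  \<open>x\<^sub>v x\<^sub>W\<close>, which vanishes because \<open>W\<close> is a facet; this contradicts freeness. Hence
  \<open>A\<^sub>i \<subseteq> W\<close> (\<open>decomposition_depth_le_facet\<close>).

  Stanley depth is a maximum over all decompositions, so the bound on each of them only bounds the
  maximum if there is at least one. The decomposition of \<open>S/I\<close> into the spaces \<open>x\<^sub>F K[F]\<close>, one
  for each face \<open>F\<close>, serves for that (\<open>ex_stanley_decomposition\<close>): \<open>x\<^sub>F K[F]\<close> is spanned by the
  monomials with support exactly \<open>F\<close>.

  For an edge ideal, \<open>\<Delta>\<close> is the complex of independent sets, and its facets are the independent
  dominating sets of the graph (\<open>sdepth_edge_ideal_le_independent_dominating\<close>). A product of such sets
  is again one in the strong product, and taking every third vertex gives one with \<open>\<lceil>n/3\<rceil>\<close>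
  vertices in the cycle or path on \<open>n\<close> vertices.
\<close>

section \<open>Polynomial rings and their quotients\<close>

lemma poly_ring_on_simps [simp]:
  "mult (poly_ring_on V) = (*)" "one (poly_ring_on V) = 1"
  "zero (poly_ring_on V) = 0" "add (poly_ring_on V) = (+)"
  by (simp_all add: poly_ring_on_def)

lemma mem_poly_ring_on:
  "p \<in> carrier (poly_ring_on V) \<longleftrightarrow>
     (\<forall>t \<in> Poly_Mapping.keys p. Poly_Mapping.keys t \<subseteq> V)"
  by (simp add: poly_ring_on_def)

lemma keys_add_exponent:
  fixes s t :: "'v \<Rightarrow>\<^sub>0 nat"
  shows "Poly_Mapping.keys (s + t) = Poly_Mapping.keys s \<union> Poly_Mapping.keys t"
  by (auto simp: in_keys_iff lookup_add)

lemma keys_minus_subset: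
  fixes s t :: "'v \<Rightarrow>\<^sub>0 nat"
  shows "Poly_Mapping.keys (s - t) \<subseteq> Poly_Mapping.keys s"
  by (auto simp: in_keys_iff lookup_minus)

lemma poly_ring_on_mult_closed:
  assumes "p \<in> carrier (poly_ring_on V)" "q \<in> carrier (poly_ring_on V)"
  shows "p * q \<in> carrier (poly_ring_on V)"
  using assms keys_mult[of p q] by (fastforce simp: mem_poly_ring_on keys_add_exponent)

lemma poly_ring_on_add_closed:
  assumes "p \<in> carrier (poly_ring_on V)" "q \<in> carrier (poly_ring_on V)"
  shows "p + q \<in> carrier (poly_ring_on V)"
  using assms Poly_Mapping.keys_add[of p q] by (auto simp: mem_poly_ring_on)

lemma poly_ring_on_uminus_closed:
  "p \<in> carrier (poly_ring_on V) \<Longrightarrow> - p \<in> carrier (poly_ring_on V)"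
  by (simp add: mem_poly_ring_on)

lemma poly_ring_on_diff_closed:
  assumes "p \<in> carrier (poly_ring_on V)" "q \<in> carrier (poly_ring_on V)"
  shows "p - q \<in> carrier (poly_ring_on V)"
  using poly_ring_on_add_closed[OF assms(1) poly_ring_on_uminus_closed[OF assms(2)]] by simp

lemma poly_ring_on_zero_closed: "0 \<in> carrier (poly_ring_on V)"
  by (simp add: mem_poly_ring_on)

lemma poly_ring_on_one_closed: "1 \<in> carrier (poly_ring_on V)"
  by (simp add: mem_poly_ring_on)

lemmas poly_ring_on_closed = poly_ring_on_mult_closed poly_ring_on_add_closed
  poly_ring_on_uminus_closed poly_ring_on_diff_closed poly_ring_on_zero_closed
  poly_ring_on_one_closed

lemma poly_ring_on_sum_closed:
  assumes "\<And>i. i \<in> A \<Longrightarrow> g i \<in> carrier (poly_ring_on V)"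
  shows "sum g A \<in> carrier (poly_ring_on V)"
  using assms
  by (induction A rule: infinite_finite_induct) (auto intro: poly_ring_on_closed)

lemma cring_poly_ring_on: "cring (poly_ring_on V :: ('v, 'k::field) mpolynomial ring)"
proof (intro cringI abelian_groupI comm_monoidI)
  fix p :: "('v, 'k) mpolynomial"
  assume "p \<in> carrier (poly_ring_on V)"
  then show "\<exists>q\<in>carrier (poly_ring_on V). q \<oplus>\<^bsub>poly_ring_on V\<^esub> p = \<zero>\<^bsub>poly_ring_on V\<^esub>"
    by (intro bexI[of _ "- p"]) (auto intro: poly_ring_on_closed)
qed (auto simp: algebra_simps intro: poly_ring_on_closed)

lemma a_inv_poly_ring_on:
  fixes p :: "('v, 'k::field) mpolynomial"
  assumes "p \<in> carrier (poly_ring_on V)"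
  shows "\<ominus>\<^bsub>poly_ring_on V\<^esub> p = - p"
proof -
  interpret cring "poly_ring_on V :: ('v, 'k) mpolynomial ring" by (rule cring_poly_ring_on)
  show ?thesis
    by (rule minus_equality) (use assms in \<open>auto intro: poly_ring_on_closed\<close>)
qed

lemma coset_eq_iff:
  fixes p q :: "('v, 'k::field) mpolynomial"
  assumes "ideal I (poly_ring_on V)"
    and p: "p \<in> carrier (poly_ring_on V)" and q: "q \<in> carrier (poly_ring_on V)"
  shows "I +>\<^bsub>poly_ring_on V\<^esub> p = I +>\<^bsub>poly_ring_on V\<^esub> q \<longleftrightarrow> p - q \<in> I"
proof -
  interpret ideal I "poly_ring_on V" by fact
  have "p \<in> I +>\<^bsub>poly_ring_on V\<^esub> q \<longleftrightarrow> p - q \<in> I"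
    using a_rcos_module[OF q p] a_inv_poly_ring_on[OF q] by simp
  then show ?thesis
    using a_repr_independence'[OF _ q] a_repr_independenceD[OF p] by metis
qed

lemma quot_module_carrier:
  "carrier (quot_module R I) = (\<lambda>p. I +>\<^bsub>R\<^esub> p) ` carrier R"
  by (auto simp: quot_module_def FactRing_def A_RCOSETS_defs a_r_coset_def)

lemma quot_module_smult:
  fixes p q :: "('v, 'k::field) mpolynomial"
  assumes "ideal I (poly_ring_on V)"
    and "p \<in> carrier (poly_ring_on V)" "q \<in> carrier (poly_ring_on V)"
  shows "p \<odot>\<^bsub>quot_module (poly_ring_on V) I\<^esub> (I +>\<^bsub>poly_ring_on V\<^esub> q) =
    I +>\<^bsub>poly_ring_on V\<^esub> (p * q)"
  using ideal.rcoset_mult_add[OF assms] by (simp add: quot_module_def FactRing_def)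

text \<open>
  Sums in the module become sums of representatives, so that identities in \<open>K[V]/I\<close> can be read off
  from coefficients of polynomials.
\<close>

lemma quot_module_finsum:
  fixes g :: "'i \<Rightarrow> ('v, 'k::field) mpolynomial"
  assumes "ideal I (poly_ring_on V)"
    and "finite A" "\<And>i. i \<in> A \<Longrightarrow> g i \<in> carrier (poly_ring_on V)"
    and "\<And>i. i \<in> A \<Longrightarrow> f i = I +>\<^bsub>poly_ring_on V\<^esub> g i"
  shows "finsum (quot_module (poly_ring_on V) I) f A = I +>\<^bsub>poly_ring_on V\<^esub> sum g A"
proof -
  let ?R = "poly_ring_on V :: ('v, 'k) mpolynomial ring"
  interpret ideal I ?R by fact
  interpret Q: ring "?R Quot I" by (rule quotient_is_ring)
  have car: "I +>\<^bsub>?R\<^esub> p \<in> carrier (?R Quot I)" if "p \<in> carrier ?R" for p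
    using that quot_module_carrier[of ?R I] by (auto simp: quot_module_def)
  have "finsum (quot_module ?R I) f A = finsum (?R Quot I) f A"
    by (simp add: finsum_def finprod_def quot_module_def)
  also have "\<dots> = I +>\<^bsub>?R\<^esub> sum g A"
    using assms(2-)
  proof (induction A rule: finite_induct)
    case empty
    have "I +>\<^bsub>?R\<^esub> 0 = I"
      using a_rcos_zero[OF is_ideal, of 0] additive_subgroup.zero_closed[OF is_additive_subgroup]
      by simp
    then show ?case unfolding Q.finsum_empty by (simp add: FactRing_def)
  next
    case (insert i A)
    have "finsum (?R Quot I) f (insert i A) = f i \<oplus>\<^bsub>?R Quot I\<^esub> finsum (?R Quot I) f A"
      using insert car by (intro Q.finsum_insert) auto
    also have "\<dots> = I +>\<^bsub>?R\<^esub> (g i + sum g A)"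
      using insert a_rcos_sum[of "g i" "sum g A"] poly_ring_on_sum_closed[of A g V]
      by (simp add: FactRing_def)
    finally show ?case using insert by simp
  qed
  finally show ?thesis .
qed

section \<open>Squarefree monomial ideals\<close>

text \<open>
  The Stanley--Reisner ideal of \<open>\<Delta>\<close>, described by the supports of the monomials that occur in its
  elements instead of by generators; membership is then a condition on coefficients.
\<close>

definition nonface_ideal :: "'v set \<Rightarrow> 'v set set \<Rightarrow> ('v, 'k::field) mpolynomial set" where
  "nonface_ideal V \<Delta> =
     {p \<in> carrier (poly_ring_on V). \<forall>t \<in> Poly_Mapping.keys p. Poly_Mapping.keys t \<notin> \<Delta>}"

lemma nonface_ideal_iff:
  "p \<in> nonface_ideal V \<Delta> \<longleftrightarrow> p \<in> carrier (poly_ring_on V) \<and>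
     (\<forall>t. Poly_Mapping.keys t \<in> \<Delta> \<longrightarrow> Poly_Mapping.lookup p t = 0)"
  unfolding nonface_ideal_def using in_keys_iff[of _ p] by auto

definition simplicial_complex :: "'v set set \<Rightarrow> bool" where
  "simplicial_complex \<Delta> \<longleftrightarrow> (\<forall>F \<in> \<Delta>. \<forall>F'. F' \<subseteq> F \<longrightarrow> F' \<in> \<Delta>)"

lemma ideal_nonface_ideal:
  assumes "simplicial_complex \<Delta>"
  shows "ideal (nonface_ideal V \<Delta> :: ('v, 'k::field) mpolynomial set) (poly_ring_on V)"
proof -
  let ?R = "poly_ring_on V :: ('v, 'k) mpolynomial ring"
  interpret cring ?R by (rule cring_poly_ring_on)
  have mult: "x * a \<in> nonface_ideal V \<Delta>"
    if a: "a \<in> nonface_ideal V \<Delta>" and x: "x \<in> carrier ?R" for a x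
  proof -
    have "Poly_Mapping.keys t \<notin> \<Delta>" if t: "t \<in> Poly_Mapping.keys (x * a)" for t
    proof -
      obtain r s where "t = r + s" "s \<in> Poly_Mapping.keys a"
        using keys_mult[of x a] t by auto
      then show ?thesis
        using a assms unfolding nonface_ideal_def simplicial_complex_def
        by (auto simp: keys_add_exponent)
    qed
    then show ?thesis
      using poly_ring_on_mult_closed[OF x, of a] a by (simp add: nonface_ideal_def)
  qed
  show ?thesis
  proof (rule idealI)
    show "subgroup (nonface_ideal V \<Delta>) (add_monoid ?R)"
    proof (rule add.subgroupI)
      show "nonface_ideal V \<Delta> \<noteq> ({} :: ('v, 'k) mpolynomial set)"
        by (auto simp: nonface_ideal_def mem_poly_ring_on intro!: exI[of _ 0])
      fix p :: "('v, 'k) mpolynomial"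
      assume p: "p \<in> nonface_ideal V \<Delta>"
      then show "\<ominus>\<^bsub>?R\<^esub> p \<in> nonface_ideal V \<Delta>"
        by (subst a_inv_poly_ring_on) (auto simp: nonface_ideal_def intro: poly_ring_on_closed)
      fix q :: "('v, 'k) mpolynomial"
      assume "q \<in> nonface_ideal V \<Delta>"
      then show "p \<oplus>\<^bsub>?R\<^esub> q \<in> nonface_ideal V \<Delta>"
        using p Poly_Mapping.keys_add[of p q] by (auto simp: nonface_ideal_def intro: poly_ring_on_closed)
    qed (auto simp: nonface_ideal_def)
  next
    fix a x :: "('v, 'k) mpolynomial"
    assume ax: "a \<in> nonface_ideal V \<Delta>" "x \<in> carrier ?R"
    show "x \<otimes>\<^bsub>?R\<^esub> a \<in> nonface_ideal V \<Delta>"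
      using mult[OF ax] by simp
    show "a \<otimes>\<^bsub>?R\<^esub> x \<in> nonface_ideal V \<Delta>"
      using mult[OF ax] by (simp add: ac_simps)
  qed (rule ring_axioms)
qed

text \<open>
  The exponent vector of the squarefree monomial \<open>x\<^sub>F\<close>.
\<close>

definition sqfree_exp :: "'v set \<Rightarrow> 'v \<Rightarrow>\<^sub>0 nat" where
  "sqfree_exp F = (\<Sum>v\<in>F. Poly_Mapping.single v 1)"

lemma lookup_sqfree_exp:
  "finite F \<Longrightarrow> Poly_Mapping.lookup (sqfree_exp F) v = (if v \<in> F then 1 else 0)"
  by (simp add: sqfree_exp_def lookup_sum lookup_single when_def)

lemma keys_sqfree_exp: "finite F \<Longrightarrow> Poly_Mapping.keys (sqfree_exp F) = F"
  by (auto simp: in_keys_iff lookup_sqfree_exp split: if_splits)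

lemma lookup_mult_single:
  fixes p :: "('v, 'k::field) mpolynomial"
  shows "Poly_Mapping.lookup (p * Poly_Mapping.single s c) (t + s) = Poly_Mapping.lookup p t * c"
proof -
  have "Poly_Mapping.lookup (p * Poly_Mapping.single s c) (t + s) =
    (\<Sum>l. Poly_Mapping.lookup p l * (\<Sum>q. (c when s = q) when t + s = l + q))"
    by (simp add: lookup_mult lookup_single)
  also have "\<dots> = (\<Sum>l. Poly_Mapping.lookup p l * c when l = t)"
  proof -
    have "(\<Sum>q. (c when s = q) when t + s = l + q) = (c when l = t)" for l
    proof -
      have "((c when s = q) when t + s = l + q) = ((c when l = t) when q = s)" for q
        by (auto simp: when_def)
      then show ?thesis by simp
    qed
    then show ?thesis by (simp add: mult_when)
  qed
  finally show ?thesis by simp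
qed

lemma sum_monomials:
  fixes p :: "('v, 'k::field) mpolynomial"
  shows "(\<Sum>t\<in>Poly_Mapping.keys p. Poly_Mapping.single t (Poly_Mapping.lookup p t)) = p"
  by (rule poly_mapping_eqI)
     (auto simp: lookup_sum lookup_single when_def in_keys_iff)

section \<open>The canonical Stanley decomposition\<close>

text \<open>
  The part of a polynomial that lies in the summand belonging to the face \<open>F\<close>.
\<close>

definition restrict_supp :: "'v set \<Rightarrow> ('v, 'k::field) mpolynomial \<Rightarrow> ('v, 'k) mpolynomial" where
  "restrict_supp F p =
     (\<Sum>t \<in> {t \<in> Poly_Mapping.keys p. Poly_Mapping.keys t = F}.
        Poly_Mapping.single t (Poly_Mapping.lookup p t))"

lemma lookup_restrict_supp:
  "Poly_Mapping.lookup (restrict_supp F p) t =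
     (if Poly_Mapping.keys t = F then Poly_Mapping.lookup p t else 0)"
  by (auto simp: restrict_supp_def lookup_sum lookup_single when_def in_keys_iff)

definition polys_with_supp :: "'v set \<Rightarrow> ('v, 'k::field) mpolynomial set" where
  "polys_with_supp F = {q. \<forall>t \<in> Poly_Mapping.keys q. Poly_Mapping.keys t = F}"

lemma polys_with_supp_iff:
  "q \<in> polys_with_supp F \<longleftrightarrow>
     (\<forall>t. Poly_Mapping.keys t \<noteq> F \<longrightarrow> Poly_Mapping.lookup q t = 0)"
  unfolding polys_with_supp_def using in_keys_iff[of _ q] by auto

text \<open>
  A monomial has support exactly \<open>F\<close> iff it is \<open>x\<^sub>F\<close> times a monomial in the variables of \<open>F\<close>.
  This turns the Stanley space \<open>x\<^sub>F K[F]\<close> into a set defined by supports.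
\<close>

lemma times_sqfree_image:
  assumes "finite F"
  shows "(\<lambda>p. p * Poly_Mapping.single (sqfree_exp F) 1) ` carrier (poly_ring_on F) =
    (polys_with_supp F :: ('v, 'k::field) mpolynomial set)"
proof (intro equalityI subsetI)
  fix q :: "('v, 'k) mpolynomial"
  assume "q \<in> (\<lambda>p. p * Poly_Mapping.single (sqfree_exp F) 1) ` carrier (poly_ring_on F)"
  then obtain p where p: "p \<in> carrier (poly_ring_on F)"
    and q: "q = p * Poly_Mapping.single (sqfree_exp F) 1" by auto
  have "Poly_Mapping.keys t = F" if t: "t \<in> Poly_Mapping.keys q" for t
  proof -
    obtain s where "t = s + sqfree_exp F" "s \<in> Poly_Mapping.keys p"
      using keys_mult[of p "Poly_Mapping.single (sqfree_exp F) (1::'k)"] t q by auto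
    then show ?thesis
      using p assms by (auto simp: mem_poly_ring_on keys_add_exponent keys_sqfree_exp)
  qed
  then show "q \<in> polys_with_supp F" by (simp add: polys_with_supp_def)
next
  fix q :: "('v, 'k) mpolynomial"
  assume q: "q \<in> polys_with_supp F"
  define p where "p = (\<Sum>t\<in>Poly_Mapping.keys q.
    Poly_Mapping.single (t - sqfree_exp F) (Poly_Mapping.lookup q t))"
  have eq: "t - sqfree_exp F + sqfree_exp F = t" if "t \<in> Poly_Mapping.keys q" for t
  proof (rule poly_mapping_eqI)
    fix v
    have "Poly_Mapping.keys t = F" using q that by (simp add: polys_with_supp_def)
    then have "v \<in> F \<Longrightarrow> Poly_Mapping.lookup t v \<noteq> 0" by (auto simp: in_keys_iff)
    then show "Poly_Mapping.lookup (t - sqfree_exp F + sqfree_exp F) v = Poly_Mapping.lookup t v"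
      using assms by (auto simp: lookup_add lookup_minus lookup_sqfree_exp)
  qed
  have "p * Poly_Mapping.single (sqfree_exp F) 1 =
    (\<Sum>t\<in>Poly_Mapping.keys q. Poly_Mapping.single t (Poly_Mapping.lookup q t))"
    unfolding p_def sum_distrib_right by (rule sum.cong) (simp_all add: mult_single eq)
  then have "p * Poly_Mapping.single (sqfree_exp F) 1 = q"
    by (simp add: sum_monomials)
  moreover have "p \<in> carrier (poly_ring_on F)"
    unfolding p_def
  proof (rule poly_ring_on_sum_closed)
    fix t assume t: "t \<in> Poly_Mapping.keys q"
    then have "Poly_Mapping.keys (t - sqfree_exp F) \<subseteq> F"
      using q t keys_minus_subset[of t "sqfree_exp F"] by (auto simp: polys_with_supp_def)
    then show "Poly_Mapping.single (t - sqfree_exp F) (Poly_Mapping.lookup q t)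
      \<in> carrier (poly_ring_on F)" by (simp add: mem_poly_ring_on)
  qed
  ultimately show "q \<in> (\<lambda>p. p * Poly_Mapping.single (sqfree_exp F) 1) ` carrier (poly_ring_on F)"
    by blast
qed

lemma poly_ring_on_mono:
  "A \<subseteq> V \<Longrightarrow> p \<in> carrier (poly_ring_on A) \<Longrightarrow> p \<in> carrier (poly_ring_on V)"
  by (auto simp: mem_poly_ring_on)

lemma inj_times_single:
  fixes p q :: "('v, 'k::field) mpolynomial"
  assumes "p * Poly_Mapping.single s 1 = q * Poly_Mapping.single s 1"
  shows "p = q"
proof (rule poly_mapping_eqI)
  fix t
  show "Poly_Mapping.lookup p t = Poly_Mapping.lookup q t"
    using lookup_mult_single[of p s 1 t] lookup_mult_single[of q s 1 t] assms by simp
qed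

text \<open>
  The monomials outside the ideal are those whose support is a face. Sorting them by their support
  splits \<open>K[V]/I\<close> into the spaces \<open>x\<^sub>F K[F]\<close>: existence of a representation comes from restricting a
  polynomial to each support, and uniqueness holds because each coefficient at a monomial
  outside the ideal is contributed by exactly one of the spaces.
\<close>

lemma ex_stanley_decomposition:
  fixes \<Delta> :: "'v set set"
  assumes V: "finite V" and \<Delta>: "simplicial_complex \<Delta>"
  defines "I \<equiv> nonface_ideal V \<Delta> :: ('v, 'k::field) mpolynomial set"
  shows "\<exists>D. stanley_decomposition V (quot_module (poly_ring_on V) I) (quot_component V I) D"
proof -
  let ?R = "poly_ring_on V :: ('v, 'k) mpolynomial ring"
  let ?M = "quot_module ?R I"
  let ?x = "\<lambda>F. Poly_Mapping.single (sqfree_exp F) 1 :: ('v, 'k) mpolynomial"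
  have I: "ideal I ?R" unfolding I_def by (rule ideal_nonface_ideal[OF \<Delta>])
  have "finite {F. F \<subseteq> V \<and> F \<in> \<Delta>}" using V by simp
  then obtain Fs where Fs: "set Fs = {F. F \<subseteq> V \<and> F \<in> \<Delta>}" "distinct Fs"
    using finite_distinct_list by metis
  define N where "N = length Fs"
  define D where "D = map (\<lambda>F. (I +>\<^bsub>?R\<^esub> ?x F, F)) Fs"
  have face: "F \<subseteq> V" "F \<in> \<Delta>" "finite F" if "F \<in> set Fs" for F
    using that Fs V finite_subset by auto
  have x: "?x F \<in> carrier ?R" if "F \<in> set Fs" for F
    using face[OF that] by (simp add: mem_poly_ring_on keys_sqfree_exp)
  have supp_carrier: "q \<in> carrier ?R" if "q \<in> polys_with_supp F" "F \<in> set Fs" for q F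
    using that face by (auto simp: mem_poly_ring_on polys_with_supp_def)
  have smult: "p \<odot>\<^bsub>?M\<^esub> (I +>\<^bsub>?R\<^esub> ?x F) = I +>\<^bsub>?R\<^esub> (p * ?x F)"
    if "p \<in> carrier (poly_ring_on F)" "F \<in> set Fs" for p F
    using quot_module_smult[OF I poly_ring_on_mono[OF face(1)[OF that(2)] that(1)] x[OF that(2)]] .
  have space: "stanley_space ?M (I +>\<^bsub>?R\<^esub> ?x F) F = (\<lambda>q. I +>\<^bsub>?R\<^esub> q) ` polys_with_supp F"
    if "F \<in> set Fs" for F
    unfolding stanley_space_def times_sqfree_image[OF face(3)[OF that], symmetric] image_image
    using smult[OF _ that] by (intro image_cong) simp_all
  have zero: "q = 0" if "q \<in> polys_with_supp F" "F \<in> set Fs" "q \<in> I" for q F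
    using that face[of F] by (force simp: polys_with_supp_def I_def nonface_ideal_def)
  have diff: "q - q' \<in> polys_with_supp F"
    if "q \<in> polys_with_supp F" "q' \<in> polys_with_supp F" for q q' and F :: "'v set"
    using that Poly_Mapping.keys_diff[of q q'] by (auto simp: polys_with_supp_def)
  have spaces: "\<forall>(w, A) \<in> set D. w \<in> carrier ?M \<and> (\<exists>a. w \<in> quot_component V I a) \<and> A \<subseteq> V \<and>
      inj_on (\<lambda>p. p \<odot>\<^bsub>?M\<^esub> w) (carrier (poly_ring_on A))"
  proof -
    have inj: "inj_on (\<lambda>p. p \<odot>\<^bsub>?M\<^esub> (I +>\<^bsub>?R\<^esub> ?x F)) (carrier (poly_ring_on F))" if F: "F \<in> set Fs" for F
    proof (rule inj_onI)
      fix p q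
      assume p: "p \<in> carrier (poly_ring_on F)" and q: "q \<in> carrier (poly_ring_on F)"
        and "p \<odot>\<^bsub>?M\<^esub> (I +>\<^bsub>?R\<^esub> ?x F) = q \<odot>\<^bsub>?M\<^esub> (I +>\<^bsub>?R\<^esub> ?x F)"
      then have "I +>\<^bsub>?R\<^esub> (p * ?x F) = I +>\<^bsub>?R\<^esub> (q * ?x F)"
        using smult F by simp
      moreover have supp: "p * ?x F \<in> polys_with_supp F" "q * ?x F \<in> polys_with_supp F"
        using times_sqfree_image[OF face(3)[OF F]] p q by blast+
      ultimately have "p * ?x F - q * ?x F \<in> I"
        using coset_eq_iff[OF I] supp_carrier F by metis
      then have "p * ?x F - q * ?x F = 0"
        by (rule zero[OF diff[OF supp] F])
      then show "p = q" using inj_times_single[of p "sqfree_exp F" q] by simp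
    qed
    have comp: "I +>\<^bsub>?R\<^esub> ?x F \<in>
        quot_component V I (\<lambda>v. int (Poly_Mapping.lookup (sqfree_exp F) v))" if "F \<in> set Fs" for F
      unfolding quot_component_def using x[OF that] by auto
    show ?thesis
    proof (intro ballI, clarify)
      fix w A assume "(w, A) \<in> set D"
      then have A: "A \<in> set Fs" and w: "w = I +>\<^bsub>?R\<^esub> ?x A" by (auto simp: D_def)
      have "w \<in> carrier ?M" unfolding w quot_module_carrier using x[OF A] by blast
      then show "w \<in> carrier ?M \<and> (\<exists>a. w \<in> quot_component V I a) \<and> A \<subseteq> V \<and>
          inj_on (\<lambda>p. p \<odot>\<^bsub>?M\<^esub> w) (carrier (poly_ring_on A))"
        using inj[OF A] comp[OF A] face(1)[OF A] unfolding w by blast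
    qed
  qed
  have direct_sum: "\<exists>!f. f \<in> (\<Pi>\<^sub>E i\<in>{..<length D}. stanley_space ?M (fst (D ! i)) (snd (D ! i))) \<and>
      z = finsum ?M f {..<length D}" if z_in: "z \<in> carrier ?M" for z
  proof -
    obtain p where p: "p \<in> carrier ?R" and z: "z = I +>\<^bsub>?R\<^esub> p"
      using z_in by (auto simp: quot_module_carrier)
    have len: "length D = N" by (simp add: D_def N_def)
    have Di: "stanley_space ?M (fst (D ! i)) (snd (D ! i)) =
        (\<lambda>q. I +>\<^bsub>?R\<^esub> q) ` polys_with_supp (Fs ! i)" if "i < N" for i
      using that space[of "Fs ! i"] by (simp add: D_def N_def)
    have mem: "Fs ! i \<in> set Fs" if "i < N" for i using that by (simp add: N_def)
    define r where "r i = restrict_supp (Fs ! i) p" for i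
    have r: "r i \<in> polys_with_supp (Fs ! i)" for i
      by (simp add: r_def polys_with_supp_iff lookup_restrict_supp)
    have sum_r: "p - sum r {..<N} \<in> I"
    proof -
      \<comment> \<open>A face inside \<open>V\<close> is listed exactly once, and \<open>p\<close> has no monomials with other faces as support.\<close>
      have "Poly_Mapping.lookup (p - sum r {..<N}) t = 0" if t: "Poly_Mapping.keys t \<in> \<Delta>" for t
      proof (cases "Poly_Mapping.keys t \<subseteq> V")
        case True
        then have "Poly_Mapping.keys t \<in> set Fs" using t Fs by simp
        then obtain j where j: "j < N" "Fs ! j = Poly_Mapping.keys t"
          by (auto simp: in_set_conv_nth N_def)
        have "Poly_Mapping.lookup (sum r {..<N}) t =
            (\<Sum>i<N. if i = j then Poly_Mapping.lookup p t else 0)"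
          unfolding lookup_sum r_def lookup_restrict_supp
          using j Fs(2) by (intro sum.cong) (auto simp: nth_eq_iff_index_eq N_def)
        then show ?thesis using j by (simp add: lookup_minus)
      next
        case False
        then have "t \<notin> Poly_Mapping.keys p" using p by (auto simp: mem_poly_ring_on)
        then have "Poly_Mapping.lookup p t = 0" by (simp add: in_keys_iff)
        then show ?thesis by (auto simp: lookup_minus lookup_sum r_def lookup_restrict_supp intro!: sum.neutral)
      qed
      moreover have "p - sum r {..<N} \<in> carrier ?R"
        by (rule poly_ring_on_diff_closed[OF p poly_ring_on_sum_closed[OF supp_carrier[OF r mem]]])
          simp
      ultimately show ?thesis
        by (simp add: I_def nonface_ideal_iff)
    qed
    have fin: "finsum ?M f {..<N} = I +>\<^bsub>?R\<^esub> sum q {..<N}"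
      if "\<And>i. i < N \<Longrightarrow> q i \<in> polys_with_supp (Fs ! i)"
        "\<And>i. i < N \<Longrightarrow> f i = I +>\<^bsub>?R\<^esub> q i" for f q
      by (rule quot_module_finsum[OF I _ supp_carrier[OF that(1) mem] that(2)]) simp_all
    have carr: "sum q {..<N} \<in> carrier ?R"
      if "\<And>i. i < N \<Longrightarrow> q i \<in> polys_with_supp (Fs ! i)" for q
      by (rule poly_ring_on_sum_closed[OF supp_carrier[OF that mem]]) simp_all
    show ?thesis
      unfolding len
    proof (rule ex_ex1I)
      define f where "f = (\<lambda>i\<in>{..<N}. I +>\<^bsub>?R\<^esub> r i)"
      have "f \<in> (\<Pi>\<^sub>E i\<in>{..<N}. stanley_space ?M (fst (D ! i)) (snd (D ! i)))"
        using r by (auto simp: f_def Di)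
      moreover have "finsum ?M f {..<N} = I +>\<^bsub>?R\<^esub> sum r {..<N}"
        using r by (intro fin) (auto simp: f_def)
      ultimately show "\<exists>f. f \<in> (\<Pi>\<^sub>E i\<in>{..<N}. stanley_space ?M (fst (D ! i)) (snd (D ! i))) \<and>
          z = finsum ?M f {..<N}"
        using coset_eq_iff[OF I p carr[OF r]] sum_r z by auto
    next
      fix f g
      assume f: "f \<in> (\<Pi>\<^sub>E i\<in>{..<N}. stanley_space ?M (fst (D ! i)) (snd (D ! i))) \<and>
          z = finsum ?M f {..<N}"
        and g: "g \<in> (\<Pi>\<^sub>E i\<in>{..<N}. stanley_space ?M (fst (D ! i)) (snd (D ! i))) \<and>
          z = finsum ?M g {..<N}"
      have "\<forall>i<N. \<exists>q \<in> polys_with_supp (Fs ! i). f i = I +>\<^bsub>?R\<^esub> q"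
        using f Di by (fastforce simp: PiE_iff)
      then obtain a where a: "\<And>i. i < N \<Longrightarrow> a i \<in> polys_with_supp (Fs ! i)"
        "\<And>i. i < N \<Longrightarrow> f i = I +>\<^bsub>?R\<^esub> a i" by metis
      have "\<forall>i<N. \<exists>q \<in> polys_with_supp (Fs ! i). g i = I +>\<^bsub>?R\<^esub> q"
        using g Di by (fastforce simp: PiE_iff)
      then obtain b where b: "\<And>i. i < N \<Longrightarrow> b i \<in> polys_with_supp (Fs ! i)"
        "\<And>i. i < N \<Longrightarrow> g i = I +>\<^bsub>?R\<^esub> b i" by metis
      have "I +>\<^bsub>?R\<^esub> sum a {..<N} = I +>\<^bsub>?R\<^esub> sum b {..<N}"
        using f g fin[OF a] fin[OF b] by simp
      then have in_I: "sum a {..<N} - sum b {..<N} \<in> I"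
        using coset_eq_iff[OF I carr[OF a(1)] carr[OF b(1)]] by blast
      have coeff: "Poly_Mapping.lookup (c i) t = 0"
        if "\<And>i. i < N \<Longrightarrow> c i \<in> polys_with_supp (Fs ! i)" "i < N" "Poly_Mapping.keys t \<noteq> Fs ! i"
        for c :: "nat \<Rightarrow> ('v, 'k) mpolynomial" and i t
        using that(1)[OF that(2)] that(3) by (simp add: polys_with_supp_iff)
      have ab: "a j = b j" if j: "j < N" for j
      proof (rule poly_mapping_eqI)
        fix t
        show "Poly_Mapping.lookup (a j) t = Poly_Mapping.lookup (b j) t"
        proof (cases "Poly_Mapping.keys t = Fs ! j")
          case True
          have *: "Poly_Mapping.lookup (sum c {..<N}) t = Poly_Mapping.lookup (c j) t"
            if c: "\<And>i. i < N \<Longrightarrow> c i \<in> polys_with_supp (Fs ! i)"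
            for c :: "nat \<Rightarrow> ('v, 'k) mpolynomial"
          proof -
            have "Poly_Mapping.lookup (c i) t = (if i = j then Poly_Mapping.lookup (c j) t else 0)"
              if "i < N" for i
              using coeff[OF c that, of t] that j True Fs(2)
              by (auto simp: nth_eq_iff_index_eq N_def)
            then have "Poly_Mapping.lookup (sum c {..<N}) t =
                (\<Sum>i<N. if i = j then Poly_Mapping.lookup (c j) t else 0)"
              unfolding lookup_sum by (intro sum.cong) auto
            then show ?thesis using j by simp
          qed
          have "Poly_Mapping.lookup (sum a {..<N} - sum b {..<N}) t = 0"
            using in_I True face(2)[OF mem[OF j]] by (simp add: I_def nonface_ideal_iff)
          then show ?thesis using *[OF a(1)] *[OF b(1)] by (simp add: lookup_minus)
        next
          case False
          then show ?thesis using coeff[OF a(1) j] coeff[OF b(1) j] by simp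
        qed
      qed
      show "f = g"
      proof
        fix i
        show "f i = g i"
          using f g a(2)[of i] b(2)[of i] ab[of i] by (cases "i < N") (auto simp: PiE_iff extensional_def)
      qed
    qed
  qed
  have "stanley_decomposition V ?M (quot_component V I) D"
    unfolding stanley_decomposition_def by (rule conjI[OF spaces ballI[OF direct_sum]])
  then show ?thesis by (rule exI)
qed

section \<open>Facets bound the Stanley depth\<close>

text \<open>
  Among the summands \<open>p\<^sub>i w\<^sub>i\<close> of the class of \<open>x\<^sub>W\<close>, one has a nonzero coefficient at
  \<open>x\<^sub>W\<close>. Since \<open>w\<^sub>i\<close> is homogeneous, it has a representative \<open>c x\<^sup>t\<close> with \<open>c \<noteq> 0\<close>, and
  \<open>x\<^sup>s x\<^sup>t = x\<^sub>W\<close> for a monomial \<open>x\<^sup>s\<close> of \<open>p\<^sub>i\<close>. A variable \<open>x\<^sub>v\<close> of \<open>A\<^sub>i\<close> outside \<open>W\<close>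
  would make \<open>x\<^sub>v x\<^sup>s\<close> a nonzero element of \<open>K[A\<^sub>i]\<close> that annihilates \<open>w\<^sub>i\<close>.
\<close>

lemma decomposition_depth_le_facet:
  fixes \<Delta> :: "'v set set"
  assumes V: "finite V" and \<Delta>: "simplicial_complex \<Delta>"
    and W: "W \<subseteq> V" "W \<in> \<Delta>" "\<And>v. v \<in> V - W \<Longrightarrow> insert v W \<notin> \<Delta>"
  defines "I \<equiv> nonface_ideal V \<Delta> :: ('v, 'k::field) mpolynomial set"
  assumes D: "stanley_decomposition V (quot_module (poly_ring_on V) I) (quot_component V I) D"
  shows "decomposition_depth D \<le> card W"
proof -
  let ?R = "poly_ring_on V :: ('v, 'k) mpolynomial ring"
  let ?M = "quot_module ?R I"
  have I: "ideal I ?R" unfolding I_def by (rule ideal_nonface_ideal[OF \<Delta>])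
  have finW: "finite W" using W V finite_subset by blast
  define N where "N = length D"
  define w where "w i = fst (D ! i)" for i
  define A where "A i = snd (D ! i)" for i
  define u where "u = sqfree_exp W"
  have keys_u: "Poly_Mapping.keys u = W" using finW by (simp add: u_def keys_sqfree_exp)
  have xu: "Poly_Mapping.single u 1 \<in> carrier ?R" using W keys_u by (simp add: mem_poly_ring_on)
  have D_i: "A i \<subseteq> V" "\<exists>a. w i \<in> quot_component V I a"
      "inj_on (\<lambda>p. p \<odot>\<^bsub>?M\<^esub> w i) (carrier (poly_ring_on (A i)))" if "i < N" for i
  proof -
    have "D ! i \<in> set D" using that by (simp add: N_def)
    note bspec[OF conjunct1[OF D[unfolded stanley_decomposition_def]] this]
    then show "A i \<subseteq> V" "\<exists>a. w i \<in> quot_component V I a"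
      "inj_on (\<lambda>p. p \<odot>\<^bsub>?M\<^esub> w i) (carrier (poly_ring_on (A i)))"
      by (simp_all add: w_def A_def case_prod_beta)
  qed
  have "I +>\<^bsub>?R\<^esub> Poly_Mapping.single u 1 \<in> carrier ?M"
    unfolding quot_module_carrier using xu by (rule imageI)
  note bspec[OF conjunct2[OF D[unfolded stanley_decomposition_def]] this]
  then obtain f where f: "f \<in> (\<Pi>\<^sub>E i\<in>{..<N}. stanley_space ?M (w i) (A i))"
      "I +>\<^bsub>?R\<^esub> Poly_Mapping.single u 1 = finsum ?M f {..<N}"
    unfolding N_def w_def A_def by (elim ex1E conjE)
  have "\<exists>q a. q \<in> carrier ?R \<and> w i = I +>\<^bsub>?R\<^esub> q \<and>
      (\<forall>t \<in> Poly_Mapping.keys q. \<forall>v. int (Poly_Mapping.lookup t v) = a v)" if "i < N" for i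
    using D_i(2)[OF that] unfolding quot_component_def by blast
  then obtain q a where q: "\<And>i. i < N \<Longrightarrow> q i \<in> carrier ?R" "\<And>i. i < N \<Longrightarrow> w i = I +>\<^bsub>?R\<^esub> q i"
      "\<And>i t v. i < N \<Longrightarrow> t \<in> Poly_Mapping.keys (q i) \<Longrightarrow> int (Poly_Mapping.lookup t v) = a i v"
    by metis
  have "\<exists>p. p \<in> carrier (poly_ring_on (A i)) \<and> f i = p \<odot>\<^bsub>?M\<^esub> w i" if "i < N" for i
    using PiE_mem[OF f(1)] that unfolding stanley_space_def by blast
  then obtain p where p: "\<And>i. i < N \<Longrightarrow> p i \<in> carrier (poly_ring_on (A i))"
      "\<And>i. i < N \<Longrightarrow> f i = p i \<odot>\<^bsub>?M\<^esub> w i"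
    by metis
  have smult: "r \<odot>\<^bsub>?M\<^esub> w i = I +>\<^bsub>?R\<^esub> (r * q i)"
    if "i < N" "r \<in> carrier (poly_ring_on (A i))" for i r
    using quot_module_smult[OF I poly_ring_on_mono[OF D_i(1)[OF that(1)] that(2)] q(1)[OF that(1)]]
      q(2)[OF that(1)] by simp
  have pq: "p i * q i \<in> carrier ?R" if "i < N" for i
    using poly_ring_on_mono[OF D_i(1)[OF that] p(1)[OF that]] q(1)[OF that]
    by (rule poly_ring_on_mult_closed)
  have "finsum ?M f {..<N} = I +>\<^bsub>?R\<^esub> (\<Sum>i<N. p i * q i)"
    by (rule quot_module_finsum[OF I]) (simp_all add: pq p smult)
  then have "I +>\<^bsub>?R\<^esub> Poly_Mapping.single u 1 = I +>\<^bsub>?R\<^esub> (\<Sum>i<N. p i * q i)"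
    using f(2) by simp
  moreover have "(\<Sum>i<N. p i * q i) \<in> carrier ?R"
    by (rule poly_ring_on_sum_closed) (simp add: pq)
  ultimately have "Poly_Mapping.single u 1 - (\<Sum>i<N. p i * q i) \<in> I"
    using coset_eq_iff[OF I xu] by blast
  then have "Poly_Mapping.lookup (Poly_Mapping.single u 1 - (\<Sum>i<N. p i * q i)) u = 0"
    using W(2) keys_u by (simp add: I_def nonface_ideal_iff)
  then have "(\<Sum>i<N. Poly_Mapping.lookup (p i * q i) u) \<noteq> 0"
    by (simp add: lookup_minus lookup_sum)
  then obtain i where "i \<in> {..<N}" and nz: "Poly_Mapping.lookup (p i * q i) u \<noteq> 0"
    by (rule sum.not_neutral_contains_not_neutral)
  then have i: "i < N" by simp
  from nz have "u \<in> Poly_Mapping.keys (p i * q i)" by (simp add: in_keys_iff)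
  then obtain s t where u: "u = s + t" and s: "s \<in> Poly_Mapping.keys (p i)"
      and t: "t \<in> Poly_Mapping.keys (q i)"
    using keys_mult[of "p i" "q i"] by blast
  define c where "c = Poly_Mapping.lookup (q i) t"
  \<comment> \<open>By homogeneity, all monomials of \<open>q i\<close> have the same exponent vector.\<close>
  have q_i: "q i = Poly_Mapping.single t c"
  proof (rule poly_mapping_eqI)
    fix t'
    have "t' = t" if "t' \<in> Poly_Mapping.keys (q i)"
    proof (rule poly_mapping_eqI)
      fix v
      show "Poly_Mapping.lookup t' v = Poly_Mapping.lookup t v"
        using q(3)[OF i that, of v] q(3)[OF i t, of v] by linarith
    qed
    then show "Poly_Mapping.lookup (q i) t' = Poly_Mapping.lookup (Poly_Mapping.single t c) t'"
      using in_keys_iff[of t' "q i"] by (auto simp: lookup_single when_def c_def)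
  qed
  have "A i \<subseteq> W"
  proof (rule ccontr)
    assume "\<not> A i \<subseteq> W"
    then obtain v where v: "v \<in> A i" "v \<notin> W" by blast
    define r where "r = (Poly_Mapping.single (s + Poly_Mapping.single v 1) 1 :: ('v, 'k) mpolynomial)"
    have r: "r \<in> carrier (poly_ring_on (A i))"
      using p(1)[OF i] s v by (auto simp: r_def mem_poly_ring_on keys_add_exponent)
    have rq: "r * q i = Poly_Mapping.single (u + Poly_Mapping.single v 1) c"
      unfolding r_def q_i by (simp add: mult_single u ac_simps)
    have "r * q i \<in> carrier ?R"
      using poly_ring_on_mono[OF D_i(1)[OF i] r] q(1)[OF i] by (rule poly_ring_on_mult_closed)
    moreover have "Poly_Mapping.lookup (r * q i) t' = 0" if "Poly_Mapping.keys t' \<in> \<Delta>" for t'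
    proof -
      have "Poly_Mapping.keys (u + Poly_Mapping.single v 1) = insert v W"
        by (simp add: keys_add_exponent keys_u)
      then have "t' \<noteq> u + Poly_Mapping.single v 1"
        using that W(3)[of v] v D_i(1)[OF i] by auto
      then show ?thesis unfolding rq by (simp add: lookup_single when_def)
    qed
    ultimately have "r * q i \<in> I" by (simp add: I_def nonface_ideal_iff)
    then have "I +>\<^bsub>?R\<^esub> (r * q i) = I +>\<^bsub>?R\<^esub> (0 * q i)"
      using coset_eq_iff[OF I \<open>r * q i \<in> carrier ?R\<close> poly_ring_on_zero_closed] by simp
    then have "r \<odot>\<^bsub>?M\<^esub> w i = 0 \<odot>\<^bsub>?M\<^esub> w i"
      using smult[OF i r] smult[OF i poly_ring_on_zero_closed] by simp
    then have "r = 0"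
      using inj_onD[OF D_i(3)[OF i] _ r poly_ring_on_zero_closed] by blast
    moreover have "Poly_Mapping.lookup r (s + Poly_Mapping.single v 1) = 1"
      unfolding r_def by simp
    ultimately show False by simp
  qed
  then have "card (A i) \<le> card W" using finW by (rule card_mono[rotated])
  moreover have "decomposition_depth D \<le> card (A i)"
    unfolding decomposition_depth_def
  proof (rule Min_le)
    have "D ! i \<in> set D" using i by (simp add: N_def)
    then show "card (A i) \<in> (\<lambda>(w, A). card A) ` set D"
      by (force simp: A_def case_prod_beta)
  qed simp
  ultimately show ?thesis by simp
qed

text \<open>
  The bound also shows that the set of depths is finite; with a decomposition at hand, its maximum is
  attained.
\<close>

theorem sdepth_quotient_le_facet:
  fixes \<Delta> :: "'v set set"
  assumes "finite V" "simplicial_complex \<Delta>"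
    and "W \<subseteq> V" "W \<in> \<Delta>" "\<And>v. v \<in> V - W \<Longrightarrow> insert v W \<notin> \<Delta>"
  shows "sdepth_quotient V (nonface_ideal V \<Delta> :: ('v, 'k::field) mpolynomial set) \<le> card W"
proof -
  let ?I = "nonface_ideal V \<Delta> :: ('v, 'k) mpolynomial set"
  let ?S = "{decomposition_depth D | D. stanley_decomposition V
    (quot_module (poly_ring_on V) ?I) (quot_component V ?I) D}"
  have "d \<le> card W" if "d \<in> ?S" for d
    using that decomposition_depth_le_facet[OF assms] by auto
  moreover from this have "finite ?S"
    by (intro finite_subset[of ?S "{..card W}"]) blast+
  moreover have "?S \<noteq> {}"
    using ex_stanley_decomposition[OF assms(1,2), where 'k = 'k] by blast
  ultimately show ?thesis
    unfolding sdepth_quotient_def stanley_depth_def by (intro Max.boundedI)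
qed

section \<open>Edge ideals\<close>

definition independent_sets :: "'v sgraph \<Rightarrow> 'v set set" where
  "independent_sets G = {F. \<forall>e \<in> edges G. \<not> e \<subseteq> F}"

lemma simplicial_complex_independent_sets: "simplicial_complex (independent_sets G)"
  by (auto simp: simplicial_complex_def independent_sets_def)

definition simple_graph :: "'v sgraph \<Rightarrow> bool" where
  "simple_graph G \<longleftrightarrow>
     (\<forall>e \<in> edges G. \<exists>u v. e = {u, v} \<and> u \<noteq> v \<and> u \<in> verts G \<and> v \<in> verts G)"

lemma simple_graph_edge_subset:
  assumes "simple_graph G" "e \<in> edges G"
  shows "e \<subseteq> verts G"
  using bspec[OF assms(1)[unfolded simple_graph_def] assms(2)] by auto

text \<open>
  A monomial is divisible by \<open>x\<^sub>u x\<^sub>v\<close> with \<open>u \<noteq> v\<close> iff its support contains both \<open>u\<close> and \<open>v\<close>.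
  Distinctness of the endpoints matters here: a loop would contribute the square of a variable,
  and the ideal would not be determined by supports.
\<close>

lemma edge_ideal_eq_nonface_ideal:
  fixes G :: "'v sgraph"
  assumes G: "simple_graph G"
  shows "edge_ideal G =
    (nonface_ideal (verts G) (independent_sets G) :: ('v, 'k::field) mpolynomial set)"
proof -
  let ?R = "poly_ring_on (verts G) :: ('v, 'k) mpolynomial ring"
  let ?N = "nonface_ideal (verts G) (independent_sets G) :: ('v, 'k) mpolynomial set"
  let ?S = "{variable u * variable v | u v. {u, v} \<in> edges G} :: ('v, 'k) mpolynomial set"
  interpret cring ?R by (rule cring_poly_ring_on)
  have N: "ideal ?N ?R" by (intro ideal_nonface_ideal simplicial_complex_independent_sets)
  have gens: "?S \<subseteq> ?N"
  proof clarify
    fix u v assume uv: "{u, v} \<in> edges G"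
    then have "{u, v} \<subseteq> verts G" by (rule simple_graph_edge_subset[OF G])
    moreover have "variable u * variable v =
        (Poly_Mapping.single (Poly_Mapping.single u 1 + Poly_Mapping.single v 1) 1 :: ('v, 'k) mpolynomial)"
      by (simp add: variable_def mult_single)
    ultimately show "variable u * variable v \<in> ?N"
      using uv by (auto simp: nonface_ideal_def mem_poly_ring_on keys_add_exponent
          independent_sets_def intro!: bexI[OF _ uv])
  qed
  have S: "?S \<subseteq> carrier ?R"
    using gens by (auto simp: nonface_ideal_def)
  have E: "ideal (edge_ideal G) ?R"
    unfolding edge_ideal_def by (rule genideal_ideal[OF S])
  interpret E: ideal "edge_ideal G" ?R by (rule E)
  show ?thesis
  proof
    show "edge_ideal G \<subseteq> ?N"
      unfolding edge_ideal_def by (rule genideal_minimal[OF N gens])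
  next
    show "?N \<subseteq> edge_ideal G"
    proof
      fix p assume p: "p \<in> ?N"
      have monom: "Poly_Mapping.single t (Poly_Mapping.lookup p t) \<in> edge_ideal G"
        if t: "t \<in> Poly_Mapping.keys p" for t
      proof -
        obtain e where e: "e \<in> edges G" "e \<subseteq> Poly_Mapping.keys t"
          using p t by (auto simp: nonface_ideal_def independent_sets_def)
        then obtain u v where uv: "e = {u, v}" "u \<noteq> v"
          using G by (auto simp: simple_graph_def)
        define d where "d = Poly_Mapping.single u (1::nat) + Poly_Mapping.single v 1"
        have t_eq: "t - d + d = t"
        proof (rule poly_mapping_eqI)
          fix x
          have "x \<in> {u, v} \<Longrightarrow> Poly_Mapping.lookup t x \<noteq> 0"
            using e uv in_keys_iff[of x t] by blast
          then show "Poly_Mapping.lookup (t - d + d) x = Poly_Mapping.lookup t x"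
            using uv by (auto simp: d_def lookup_add lookup_minus lookup_single when_def)
        qed
        have "Poly_Mapping.single (t - d) (Poly_Mapping.lookup p t) \<in> carrier ?R"
        proof -
          have "Poly_Mapping.keys (t - d) \<subseteq> Poly_Mapping.keys t" by (rule keys_minus_subset)
          moreover have "Poly_Mapping.keys t \<subseteq> verts G"
            using p t by (auto simp: nonface_ideal_def mem_poly_ring_on)
          ultimately show ?thesis by (auto simp: mem_poly_ring_on)
        qed
        moreover have "(variable u * variable v :: ('v, 'k) mpolynomial) \<in> edge_ideal G"
          unfolding edge_ideal_def
          by (rule subsetD[OF genideal_self[OF S]]) (use e(1) uv(1) in auto)
        ultimately have "Poly_Mapping.single (t - d) (Poly_Mapping.lookup p t) *
            (variable u * variable v) \<in> edge_ideal G"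
          using E.I_l_closed by simp
        moreover have "variable u * variable v = (Poly_Mapping.single d 1 :: ('v, 'k) mpolynomial)"
          by (simp add: variable_def mult_single d_def)
        ultimately show ?thesis by (simp add: mult_single t_eq)
      qed
      have "(\<Sum>t\<in>T. Poly_Mapping.single t (Poly_Mapping.lookup p t)) \<in> edge_ideal G"
        if "T \<subseteq> Poly_Mapping.keys p" for T
        using finite_subset[OF that finite_keys] that
      proof (induction T rule: finite_induct)
        case empty
        show ?case using E.zero_closed by simp
      next
        case (insert t T)
        then show ?case using E.a_closed[OF monom[of t]] by simp
      qed
      then show "p \<in> edge_ideal G" using sum_monomials[of p] by (metis order_refl)
    qed
  qed
qed

definition independent_dominating :: "'v sgraph \<Rightarrow> 'v set \<Rightarrow> bool" where
  "independent_dominating G W \<longleftrightarrow>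
     W \<subseteq> verts G \<and> (\<forall>u\<in>W. \<forall>v\<in>W. {u, v} \<notin> edges G) \<and>
     (\<forall>v \<in> verts G - W. \<exists>w\<in>W. {v, w} \<in> edges G)"

text \<open>
  Domination is the facet condition: adding a vertex outside \<open>W\<close> to \<open>W\<close> creates an edge.
\<close>

theorem sdepth_edge_ideal_le_independent_dominating:
  fixes G :: "'v sgraph"
  assumes fin: "finite (verts G)" and G: "simple_graph G" and W: "independent_dominating G W"
  shows "sdepth_quotient (verts G) (edge_ideal G :: ('v, 'k::field) mpolynomial set) \<le> card W"
  unfolding edge_ideal_eq_nonface_ideal[OF G]
proof (rule sdepth_quotient_le_facet[OF fin simplicial_complex_independent_sets])
  show "W \<subseteq> verts G" using W by (simp add: independent_dominating_def)
  show "W \<in> independent_sets G"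
    using W G by (fastforce simp: independent_dominating_def independent_sets_def simple_graph_def)
  show "insert v W \<notin> independent_sets G" if "v \<in> verts G - W" for v
    using W that unfolding independent_dominating_def independent_sets_def by fastforce
qed

section \<open>Independent dominating sets in strong products of cycles and paths\<close>

lemma edge_strong_product:
  "{(a, b), (a', b')} \<in> edges (strong_product G H) \<longleftrightarrow>
     a \<in> verts G \<and> a' \<in> verts G \<and> b \<in> verts H \<and> b' \<in> verts H \<and> (a, b) \<noteq> (a', b') \<and>
     (a = a' \<or> {a, a'} \<in> edges G) \<and> (b = b' \<or> {b, b'} \<in> edges H)"
  unfolding strong_product_def snd_conv mem_Collect_eq doubleton_eq_iff
  by (auto simp: insert_commute)

lemma simple_graph_strong_product: "simple_graph (strong_product G H)"
  unfolding simple_graph_def strong_product_def by fastforce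

text \<open>
  In a strong product, adjacency means that both coordinates are equal or adjacent. Coordinates
  taken from independent sets can only be equal, never adjacent, which gives independence; dominating
  each coordinate separately gives domination.
\<close>

lemma independent_dominating_strong_product:
  assumes A: "independent_dominating G A" and B: "independent_dominating H B"
  shows "independent_dominating (strong_product G H) (A \<times> B)"
proof -
  have verts: "verts (strong_product G H) = verts G \<times> verts H"
    by (simp add: strong_product_def)
  have "\<exists>w\<in>A \<times> B. {(v, u), w} \<in> edges (strong_product G H)"
    if vu: "v \<in> verts G" "u \<in> verts H" "(v, u) \<notin> A \<times> B" for v u
  proof -
    obtain a where a: "a \<in> A" "v = a \<or> {v, a} \<in> edges G"
      using A vu(1) unfolding independent_dominating_def by (metis DiffI)
    obtain b where b: "b \<in> B" "u = b \<or> {u, b} \<in> edges H"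
      using B vu(2) unfolding independent_dominating_def by (metis DiffI)
    have "a \<in> verts G" "b \<in> verts H" "(v, u) \<noteq> (a, b)"
      using A B a b vu by (auto simp: independent_dominating_def)
    then have "{(v, u), (a, b)} \<in> edges (strong_product G H)"
      using a b vu by (simp add: edge_strong_product)
    then show ?thesis using a b by blast
  qed
  moreover have "{w, w'} \<notin> edges (strong_product G H)" if "w \<in> A \<times> B" "w' \<in> A \<times> B" for w w'
    using that A B by (auto simp: edge_strong_product independent_dominating_def)
  moreover have "A \<times> B \<subseteq> verts (strong_product G H)"
    using A B by (auto simp: verts independent_dominating_def)
  ultimately show ?thesis
    unfolding independent_dominating_def verts by auto
qed

text \<open>
  The vertices \<open>2, 5, 8, \<dots>\<close>, each of which dominates a block of at most three. If \<open>n mod 3 = 1\<close>, the last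
  vertex \<open>n\<close> is left over and is added. For \<open>n \<ge> 3\<close> the set avoids \<open>1\<close>, so the additional edge
  \<open>{n, 1}\<close> of the cycle does not destroy independence, and one set serves both graphs.
\<close>

definition every_third :: "nat \<Rightarrow> nat set" where
  "every_third n = {i. i \<le> n \<and> (i mod 3 = 2 \<or> i = n \<and> n mod 3 = 1)}"

lemma card_every_third: "card (every_third n) \<le> (n + 2) div 3"
proof -
  \<comment> \<open>The minimum only matters for the last \<open>k\<close>: if \<open>n mod 3 = 1\<close>, it replaces \<open>n + 1\<close> by \<open>n\<close>.\<close>
  have "every_third n \<subseteq> (\<lambda>k. min (3 * k + 2) n) ` {..<(n + 2) div 3}"
  proof
    fix i assume "i \<in> every_third n"
    then have i: "i \<le> n" "i mod 3 = 2 \<or> i = n \<and> n mod 3 = 1" by (auto simp: every_third_def)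
    have "3 * (i div 3) + i mod 3 = i" by simp
    with i have "i = min (3 * (i div 3) + 2) n" by (elim disjE) simp_all
    moreover have "i div 3 < (n + 2) div 3" using i by (elim disjE) presburger+
    ultimately show "i \<in> (\<lambda>k. min (3 * k + 2) n) ` {..<(n + 2) div 3}" by blast
  qed
  then have "card (every_third n) \<le> card {..<(n + 2) div 3}"
    by (rule surj_card_le[rotated]) simp
  then show ?thesis by simp
qed

lemma every_third_subset: "every_third n \<subseteq> {1..n}"
proof
  fix i assume "i \<in> every_third n"
  then show "i \<in> {1..n}" by (cases i) (auto simp: every_third_def)
qed

lemma every_third_not_consecutive:
  assumes "i \<in> every_third n" "j \<in> every_third n"
  shows "j \<noteq> i + 1"
proof
  assume j: "j = i + 1"
  with assms have "i mod 3 = 2" by (auto simp: every_third_def)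
  then have "j mod 3 = 0" using j by presburger
  then show False using assms(2) by (auto simp: every_third_def)
qed

lemma every_third_dominates:
  assumes v: "1 \<le> v" "v \<le> n" "v \<notin> every_third n"
  shows "\<exists>w \<in> every_third n. w = v + 1 \<or> v = w + 1"
proof -
  have "v mod 3 = 1 \<and> v \<noteq> n \<or> v mod 3 = 0"
    using v by (auto simp: every_third_def)
  then show ?thesis
  proof
    assume "v mod 3 = 1 \<and> v \<noteq> n"
    then have "(v + 1) mod 3 = 2" "v + 1 \<le> n" using v(2) by (presburger, linarith)
    then have "v + 1 \<in> every_third n" by (simp add: every_third_def)
    then show ?thesis by blast
  next
    assume "v mod 3 = 0"
    then obtain w where w: "v = w + 1" using v(1) by (cases v) auto
    with \<open>v mod 3 = 0\<close> have "w mod 3 = 2" by presburger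
    then have "w \<in> every_third n" using v(2) w by (simp add: every_third_def)
    then show ?thesis using w by blast
  qed
qed

lemma edge_path_graph:
  "{i, j} \<in> edges (path_graph m) \<longleftrightarrow>
     1 \<le> i \<and> 1 \<le> j \<and> i \<le> m \<and> j \<le> m \<and> (j = i + 1 \<or> i = j + 1)"
  unfolding path_graph_def by (auto simp: doubleton_eq_iff)

lemma edge_cycle_graph:
  "{i, j} \<in> edges (cycle_graph n) \<longleftrightarrow>
     {i, j} \<in> edges (path_graph n) \<or> i = n \<and> j = 1 \<or> i = 1 \<and> j = n"
  unfolding cycle_graph_def path_graph_def by (auto simp: doubleton_eq_iff)

lemma independent_dominating_path: "independent_dominating (path_graph m) (every_third m)"
proof -
  have verts: "verts (path_graph m) = {1..m}" by (simp add: path_graph_def)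
  have "\<exists>w \<in> every_third m. {v, w} \<in> edges (path_graph m)"
    if v: "1 \<le> v" "v \<le> m" "v \<notin> every_third m" for v
  proof -
    obtain w where w: "w \<in> every_third m" "w = v + 1 \<or> v = w + 1"
      using every_third_dominates[OF v] by blast
    then have "1 \<le> w" "w \<le> m" using every_third_subset[of m] by auto
    then show ?thesis using v w edge_path_graph[of v w m] by blast
  qed
  moreover have "{v, w} \<notin> edges (path_graph m)" if "v \<in> every_third m" "w \<in> every_third m" for v w
    using every_third_not_consecutive[OF that] every_third_not_consecutive[OF that(2,1)]
    unfolding edge_path_graph by blast
  ultimately show ?thesis
    using every_third_subset[of m] unfolding independent_dominating_def verts by auto
qed

lemma independent_dominating_cycle:
  assumes "n \<ge> 3"
  shows "independent_dominating (cycle_graph n) (every_third n)"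
proof -
  have "1 \<notin> every_third n" using assms by (auto simp: every_third_def)
  moreover have "verts (cycle_graph n) = verts (path_graph n)"
    by (simp add: cycle_graph_def path_graph_def)
  ultimately show ?thesis
    using independent_dominating_path[of n]
    unfolding independent_dominating_def edge_cycle_graph by metis
qed

theorem theorem5p5:
  fixes n m :: nat
  assumes "n \<ge> 3" and "m \<ge> 1"
  shows "int (sdepth_quotient (verts (cycle_strong_path n m))
                (edge_ideal (cycle_strong_path n m) :: (nat \<times> nat, 'k::field) mpolynomial set))
           \<le> \<lceil>real n / 3\<rceil> * \<lceil>real m / 3\<rceil>"
proof -
  let ?G = "cycle_strong_path n m"
  let ?W = "every_third n \<times> every_third m"
  have ceil: "\<lceil>real k / 3\<rceil> = int ((k + 2) div 3)" for k
    by (rule ceiling_unique) linarith+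
  have "finite (verts ?G)"
    by (simp add: cycle_strong_path_def strong_product_def cycle_graph_def path_graph_def)
  moreover have "simple_graph ?G"
    unfolding cycle_strong_path_def by (rule simple_graph_strong_product)
  moreover have "independent_dominating ?G ?W"
    unfolding cycle_strong_path_def
    by (intro independent_dominating_strong_product independent_dominating_cycle
        independent_dominating_path assms)
  ultimately have "sdepth_quotient (verts ?G)
      (edge_ideal ?G :: (nat \<times> nat, 'k) mpolynomial set) \<le> card ?W"
    by (rule sdepth_edge_ideal_le_independent_dominating)
  also have "\<dots> \<le> ((n + 2) div 3) * ((m + 2) div 3)"
    unfolding card_cartesian_product by (intro mult_mono card_every_third) simp_all
  finally show ?thesis
    unfolding ceil of_nat_mult[symmetric] of_nat_le_iff .
qed

end
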